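(* Let $G=(V,E)$ be a finite simple undirected graph and let $h$ be a positive integer. Then for every edge $e\in E$, $\lim_{n\to\infty}H^{(n)}\mathrm{sup}(e)=t(e,h)-2$, where $H^{(n)}\mathrm{sup}$ is the higher-order H-index sequence and $t(e,h)$ the $h$-trussness, both defined below.
   Context: For a graph $S$, $\mathrm{dist}_S$ is shortest-path distance in $S$; for a vertex $x$, $N_S(x,h)=\{y\neq x:\mathrm{dist}_S(x,y)\le h\}$; for an edge $e=(u,v)$ of $S$, $\triangle_S(e,h)=N_S(u,h)\cap N_S(v,h)$ (common $h$-neighbors) and $\sup_S(e,h)=|\triangle_S(e,h)|$ ($h$-support). A subgraph $S=(V_S,E_S)$ of $G$ has $V_S\subseteq V$, $E_S\subseteq E$, with endpoints of edges of $E_S$ in $V_S$; $h$-supports in $S$ use distances in $S$. For an integer $k$, the $(k,h)$-truss of $G$ is the maximal subgraph $S$ of $G$ with $\sup_S(f,h)\ge k-2$ for all $f\in E_S$. The $h$-trussness $t(e,h)$ of $e\in E$ is the largest $k$ such that the $(k,h)$-truss of $G$ contains $e$. For a finite multiset $M$ of nonnegative integers, $\mathcal{H}(M)$ is the largest integer $y\ge 0$ such that at least $y$ elements of $M$ are $\ge y$. Define $H^{(0)}\mathrm{sup}(e)=\sup_G(e,h)$ for $e\in E$. For $n\ge1$ and vertices $a,b$, let $P^{(n)}(a,b)=\max_p\min\{H^{(n-1)}\mathrm{sup}(f): f\text{ an edge of }p\}$ over all paths $p$ in $G$ from $a$ to $b$ with at most $h$ edges; and for $e=(u,v)\in E$ let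 $H^{(n)}\mathrm{sup}(e)=\mathcal{H}\big(\{\min(P^{(n)}(u,w),P^{(n)}(v,w)) : w\in\triangle_G(e,h)\}\big)$ (a multiset indexed by $w$). *)

theory Defs
  imports Complex_Main "HOL-Library.Multiset" "HOL-Library.Extended_Nat"
begin

text \<open>An undirected edge with ends \<open>u\<close> and \<open>v\<close> is the two-element set \<open>{u, v}\<close>.\<close>

datatype 'a ugraph = UGraph (verts: "'a set") (edges: "'a set set")

definition finite_simple_graph :: "'a ugraph \<Rightarrow> bool" where
  "finite_simple_graph G \<longleftrightarrow>
     finite (verts G) \<and> (\<forall>e\<in>edges G. e \<subseteq> verts G \<and> card e = 2)"

definition subgraph :: "'a ugraph \<Rightarrow> 'a ugraph \<Rightarrow> bool" where
  "subgraph S G \<longleftrightarrow>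
     verts S \<subseteq> verts G \<and> edges S \<subseteq> edges G \<and> (\<forall>e\<in>edges S. e \<subseteq> verts S)"

text \<open>A path is given by its nonempty list of pairwise distinct vertices.\<close>

fun path_edges :: "'a list \<Rightarrow> 'a set list" where
  "path_edges (x # y # xs) = {x, y} # path_edges (y # xs)"
| "path_edges _ = []"

definition paths :: "'a ugraph \<Rightarrow> 'a \<Rightarrow> 'a \<Rightarrow> 'a list set" where
  "paths S a b =
     {p. p \<noteq> [] \<and> hd p = a \<and> last p = b \<and> distinct p \<and>
         set p \<subseteq> verts S \<and> set (path_edges p) \<subseteq> edges S}"

text \<open>The distance is \<open>\<infinity>\<close> (the infimum of the empty set) if there is no path.\<close>

definition gdist :: "'a ugraph \<Rightarrow> 'a \<Rightarrow> 'a \<Rightarrow> enat" where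
  "gdist S x y = (INF p\<in>paths S x y. enat (length (path_edges p)))"

definition nbrs :: "'a ugraph \<Rightarrow> nat \<Rightarrow> 'a \<Rightarrow> 'a set" where
  "nbrs S h x = {y \<in> verts S. y \<noteq> x \<and> gdist S x y \<le> enat h}"

text \<open>Quantities attached to an edge range over its set of ends, so that they do not
  depend on an orientation of the edge.\<close>

definition common_nbrs :: "'a ugraph \<Rightarrow> nat \<Rightarrow> 'a set \<Rightarrow> 'a set" where
  "common_nbrs S h e = (\<Inter>x\<in>e. nbrs S h x)"

lemma common_nbrs_ends: "common_nbrs S h {u, v} = nbrs S h u \<inter> nbrs S h v"
  by (simp add: common_nbrs_def)

definition support :: "'a ugraph \<Rightarrow> nat \<Rightarrow> 'a set \<Rightarrow> nat" where
  "support S h e = card (common_nbrs S h e)"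

text \<open>Here \<open>k\<close> is an integer, so \<open>k - 2\<close> is not truncated at \<open>0\<close>.\<close>

definition truss_subgraph :: "'a ugraph \<Rightarrow> nat \<Rightarrow> int \<Rightarrow> 'a ugraph \<Rightarrow> bool" where
  "truss_subgraph G h k S \<longleftrightarrow>
     subgraph S G \<and> (\<forall>f\<in>edges S. int (support S h f) \<ge> k - 2)"

definition truss :: "'a ugraph \<Rightarrow> nat \<Rightarrow> int \<Rightarrow> 'a ugraph" where
  "truss G h k =
     (THE S. truss_subgraph G h k S \<and>
             (\<forall>S'. truss_subgraph G h k S' \<and> subgraph S S' \<longrightarrow> S' = S))"

definition trussness :: "'a ugraph \<Rightarrow> nat \<Rightarrow> 'a set \<Rightarrow> int" where
  "trussness G h e = (GREATEST k. e \<in> edges (truss G h k))"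

definition h_index :: "nat multiset \<Rightarrow> nat" where
  "h_index M = (GREATEST y. size {#x \<in># M. x \<ge> y#} \<ge> y)"

text \<open>The maximum over paths of the least value of \<open>\<phi>\<close> on an edge of the path. It is
  meaningful for \<open>a \<noteq> b\<close> at distance at most \<open>h\<close>: otherwise the maximum is over no path, or
  (for \<open>a = b\<close>) the minimum is over no edge. Only pairs of the former kind occur below, since
  \<open>common_nbrs\<close> excludes the ends of the edge.\<close>

definition bottleneck :: "'a ugraph \<Rightarrow> nat \<Rightarrow> ('a set \<Rightarrow> nat) \<Rightarrow> 'a \<Rightarrow> 'a \<Rightarrow> nat" where
  "bottleneck G h \<phi> a b =
     Max ((\<lambda>p. Min (\<phi> ` set (path_edges p))) ` {p \<in> paths G a b. length (path_edges p) \<le> h})"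

primrec H_sup :: "'a ugraph \<Rightarrow> nat \<Rightarrow> nat \<Rightarrow> 'a set \<Rightarrow> nat" where
  "H_sup G h 0 = support G h"
| "H_sup G h (Suc n) = (\<lambda>e. h_index
     {# Min ((\<lambda>x. bottleneck G h (H_sup G h n) x w) ` e). w \<in># mset_set (common_nbrs G h e) #})"

lemma H_sup_Suc_ends:
  "H_sup G h (Suc n) {u, v} = h_index
     {# min (bottleneck G h (H_sup G h n) u w) (bottleneck G h (H_sup G h n) v w).
        w \<in># mset_set (nbrs G h u \<inter> nbrs G h v) #}"
  by (simp add: common_nbrs_ends)

end

theory Submission
  imports Defs
begin

text \<open>
  Let \<open>L\<close> be the spanning subgraph of \<open>G\<close> formed by the edges \<open>f\<close> with \<open>H\<^sup>(\<^sup>n\<^sup>)sup(f) \<ge> m\<close>.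
  Unfolding the H-index and the bottleneck values gives
  \<open>H\<^sup>(\<^sup>n\<^sup>+\<^sup>1\<^sup>)sup(e) \<ge> m\<close> iff \<open>sup\<^sub>L(e,h) \<ge> m\<close>. As the \<open>h\<close>-support is monotone in the graph, the
  sequence is decreasing, hence eventually constant, and it never drops below \<open>k - 2\<close> on
  a subgraph all of whose supports are at least \<open>k - 2\<close>. Conversely, once the sequence is
  constant, \<open>L\<close> itself has all its supports at least \<open>m\<close>, so it lies in the \<open>(m+2,h)\<close>-truss.
\<close>

section \<open>Decreasing sequences of naturals and the H-index\<close>

lemma nat_decseq_eventually_const:
  fixes f :: "nat \<Rightarrow> nat"
  assumes "decseq f"
  shows "\<exists>l. eventually (\<lambda>n. f n = l) sequentially"
proof -
  \<comment> \<open>Well-ordering makes the infimum of the range an attained value; a decreasing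
    sequence cannot leave it.\<close>
  obtain N where N: "f N = Inf (range f)"
    using Inf_nat_def1[of "range f"] by auto
  have "f n = f N" if "n \<ge> N" for n
  proof (rule antisym)
    show "f n \<le> f N"
      using assms that by (rule decseqD)
    show "f N \<le> f n"
      unfolding N by (rule wellorder_Inf_le1) simp
  qed
  then show ?thesis
    by (auto simp: eventually_sequentially)
qed

lemma size_filter_ge_antimono:
  fixes M :: "nat multiset"
  assumes "m \<le> y"
  shows "size {#x \<in># M. x \<ge> y#} \<le> size {#x \<in># M. x \<ge> m#}"
  using assms by (intro size_mset_mono filter_mset_mono_strong) auto

text \<open>The admissible thresholds contain 0, are bounded by \<open>size M\<close> and are closed
  downwards, so the greatest one determines them all. This replaces \<open>GREATEST\<close> by a
  test at a single \<open>m\<close>.\<close>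

lemma le_h_index_iff: "m \<le> h_index M \<longleftrightarrow> m \<le> size {#x \<in># M. x \<ge> m#}"
proof -
  let ?P = "\<lambda>y. size {#x \<in># M. x \<ge> y#} \<ge> y"
  have bound: "y \<le> size M" if "?P y" for y
    using that size_filter_mset_lesseq[of "\<lambda>x. x \<ge> y" M] by linarith
  have P: "?P (h_index M)"
    unfolding h_index_def by (rule GreatestI_nat[where k = 0 and b = "size M"]) (auto intro: bound)
  show ?thesis
  proof
    assume "m \<le> h_index M"
    then show "?P m"
      using P size_filter_ge_antimono[of m "h_index M" M] by linarith
  next
    assume "?P m"
    then show "m \<le> h_index M"
      unfolding h_index_def by (rule Greatest_le_nat) (rule bound)
  qed
qed

lemma le_h_index_image_iff:
  assumes "finite A"
  shows "m \<le> h_index {#f w. w \<in># mset_set A#} \<longleftrightarrow> m \<le> card {w \<in> A. m \<le> f w}"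
  using assms by (simp add: le_h_index_iff filter_mset_image_mset filter_mset_mset_set)

section \<open>Paths, distances and monotonicity of supports\<close>

lemma gdist_le_iff:
  "gdist S x y \<le> enat h \<longleftrightarrow> (\<exists>p\<in>paths S x y. length (path_edges p) \<le> h)"
proof
  assume le: "gdist S x y \<le> enat h"
  let ?D = "(\<lambda>p. enat (length (path_edges p))) ` paths S x y"
  \<comment> \<open>An empty \<open>?D\<close> would have infimum \<open>\<infinity>\<close>, above
    the finite bound; a nonempty set in \<open>enat\<close> attains its infimum.\<close>
  have "?D \<noteq> {}"
    using le by (auto simp: gdist_def Inf_enat_def)
  then have "Inf ?D \<in> ?D"
    by (metis Inf_enat_def LeastI ex_in_conv)
  then show "\<exists>p\<in>paths S x y. length (path_edges p) \<le> h"
    using le by (auto simp: gdist_def)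
next
  assume "\<exists>p\<in>paths S x y. length (path_edges p) \<le> h"
  then obtain p where "p \<in> paths S x y" "length (path_edges p) \<le> h"
    by blast
  then show "gdist S x y \<le> enat h"
    unfolding gdist_def by (intro INF_lower2[of p]) auto
qed

lemma nbrs_iff:
  "w \<in> nbrs S h x \<longleftrightarrow> w \<in> verts S \<and> w \<noteq> x \<and> (\<exists>p\<in>paths S x w. length (path_edges p) \<le> h)"
  by (simp add: nbrs_def gdist_le_iff)

lemma path_edges_nonempty:
  assumes "p \<in> paths S a b" "a \<noteq> b"
  shows "path_edges p \<noteq> []"
  using assms by (cases p rule: path_edges.cases) (auto simp: paths_def)

lemma finite_paths:
  assumes "finite (verts S)"
  shows "finite (paths S a b)"
proof (rule finite_subset)
  show "paths S a b \<subseteq> {p. set p \<subseteq> verts S \<and> distinct p}"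
    by (auto simp: paths_def)
qed (use assms finite_subset_distinct in blast)

lemma paths_mono:
  assumes "subgraph S T"
  shows "paths S a b \<subseteq> paths T a b"
  using assms by (auto simp: paths_def subgraph_def)

lemma nbrs_mono:
  assumes "subgraph S T"
  shows "nbrs S h x \<subseteq> nbrs T h x"
  using assms paths_mono[OF assms] unfolding nbrs_iff subgraph_def subset_iff by blast

lemma common_nbrs_mono:
  assumes "subgraph S T"
  shows "common_nbrs S h e \<subseteq> common_nbrs T h e"
  unfolding common_nbrs_def using nbrs_mono[OF assms] by fast

lemma finite_common_nbrs:
  assumes "finite (verts S)" "e \<noteq> {}"
  shows "finite (common_nbrs S h e)"
proof (rule finite_subset)
  show "common_nbrs S h e \<subseteq> verts S"
    using assms(2) by (auto simp: common_nbrs_def nbrs_def)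
qed (fact assms(1))

lemma support_mono:
  assumes "subgraph S T" "finite (verts T)" "e \<noteq> {}"
  shows "support S h e \<le> support T h e"
  unfolding support_def
  by (intro card_mono finite_common_nbrs common_nbrs_mono assms)

lemma edge_nonempty:
  assumes "finite_simple_graph G" "e \<in> edges G"
  shows "e \<noteq> {}"
  using assms by (auto simp: finite_simple_graph_def)

section \<open>Superlevel subgraphs and one step of the iteration\<close>

definition level :: "'a ugraph \<Rightarrow> ('a set \<Rightarrow> nat) \<Rightarrow> nat \<Rightarrow> 'a ugraph" where
  "level G \<phi> m = UGraph (verts G) {f \<in> edges G. m \<le> \<phi> f}"

lemma verts_level [simp]: "verts (level G \<phi> m) = verts G"
  and edges_level [simp]: "edges (level G \<phi> m) = {f \<in> edges G. m \<le> \<phi> f}"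
  by (simp_all add: level_def)

lemma subgraph_level:
  assumes "finite_simple_graph G"
  shows "subgraph (level G \<phi> m) G"
  using assms by (auto simp: subgraph_def finite_simple_graph_def)

lemma subgraph_level_mono:
  assumes "finite_simple_graph G" "\<And>f. f \<in> edges G \<Longrightarrow> \<phi> f \<le> \<psi> f"
  shows "subgraph (level G \<phi> m) (level G \<psi> m)"
  using assms by (force simp: subgraph_def finite_simple_graph_def)

lemma paths_level:
  "p \<in> paths (level G \<phi> m) a b \<longleftrightarrow> p \<in> paths G a b \<and> (\<forall>f\<in>set (path_edges p). m \<le> \<phi> f)"
  by (auto simp: paths_def)

text \<open>A maximum over a finite nonempty set reaches \<open>m\<close> iff some path does, and
  such a path is one all of whose edges survive in the level graph. Membership in
  \<open>nbrs G h x\<close> provides the nonempty set.\<close>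

lemma le_bottleneck_iff:
  assumes "finite (verts G)" "w \<in> nbrs G h x"
  shows "m \<le> bottleneck G h \<phi> x w \<longleftrightarrow> w \<in> nbrs (level G \<phi> m) h x"
proof -
  let ?Q = "{p \<in> paths G x w. length (path_edges p) \<le> h}"
  have "finite ?Q" "?Q \<noteq> {}" "x \<noteq> w" "w \<in> verts G"
    using assms finite_paths[OF assms(1)] by (auto simp: nbrs_iff)
  then have "m \<le> bottleneck G h \<phi> x w \<longleftrightarrow> (\<exists>p\<in>?Q. m \<le> Min (\<phi> ` set (path_edges p)))"
    unfolding bottleneck_def by (subst Max_ge_iff) auto
  \<comment> \<open>Since \<open>x\<close> and \<open>w\<close> differ, every path has an edge, so
    \<open>Min\<close> is taken over a nonempty set.\<close>
  also have "\<dots> \<longleftrightarrow> (\<exists>p\<in>?Q. \<forall>f\<in>set (path_edges p). m \<le> \<phi> f)"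
    using path_edges_nonempty[OF _ \<open>x \<noteq> w\<close>, of _ G] by (intro bex_cong) (auto simp: Min_ge_iff)
  also have "\<dots> \<longleftrightarrow> w \<in> nbrs (level G \<phi> m) h x"
    using \<open>x \<noteq> w\<close> \<open>w \<in> verts G\<close> by (auto simp: nbrs_iff paths_level)
  finally show ?thesis .
qed

lemma le_H_sup_Suc_iff:
  assumes G: "finite_simple_graph G" and e: "e \<in> edges G"
  shows "m \<le> H_sup G h (Suc n) e \<longleftrightarrow> m \<le> support (level G (H_sup G h n) m) h e"
proof -
  let ?L = "level G (H_sup G h n) m"
  let ?b = "bottleneck G h (H_sup G h n)"
  have fin: "finite (verts G)" and "finite e" and ne: "e \<noteq> {}"
    using G e edge_nonempty[OF G e] by (auto simp: finite_simple_graph_def intro: finite_subset)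
  have "{w \<in> common_nbrs G h e. m \<le> Min ((\<lambda>x. ?b x w) ` e)}
      = {w \<in> common_nbrs G h e. \<forall>x\<in>e. m \<le> ?b x w}"
    using \<open>finite e\<close> ne by (simp add: Min_ge_iff)
  also have "\<dots> = {w \<in> common_nbrs G h e. \<forall>x\<in>e. w \<in> nbrs ?L h x}"
    by (intro Collect_cong conj_cong ball_cong le_bottleneck_iff[OF fin] refl)
      (simp add: common_nbrs_def)
  also have "\<dots> = common_nbrs ?L h e"
    using common_nbrs_mono[OF subgraph_level[OF G, of "H_sup G h n" m], of h e]
    by (simp add: common_nbrs_def) blast
  finally show ?thesis
    by (simp add: le_h_index_image_iff finite_common_nbrs[OF fin ne] support_def)
qed

section \<open>Monotone decrease and stabilization\<close>

lemma H_sup_Suc_le: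
  assumes G: "finite_simple_graph G" and "e \<in> edges G"
  shows "H_sup G h (Suc n) e \<le> H_sup G h n e"
  using assms(2)
proof (induction n arbitrary: e)
  case 0
  let ?m = "H_sup G h (Suc 0) e"
  have "?m \<le> support (level G (H_sup G h 0) ?m) h e"
    using le_H_sup_Suc_iff[OF G 0] by blast
  also have "\<dots> \<le> support G h e"
    using G 0 by (intro support_mono subgraph_level edge_nonempty)
      (auto simp: finite_simple_graph_def)
  finally show ?case
    by simp
next
  case (Suc n)
  \<comment> \<open>The new value itself serves as threshold: by induction the later level graph
    lies in the earlier one, so the support bound transfers and is read back as a bound on the
    earlier value.\<close>
  let ?m = "H_sup G h (Suc (Suc n)) e"
  have "?m \<le> support (level G (H_sup G h (Suc n)) ?m) h e"
    using le_H_sup_Suc_iff[OF G Suc.prems] by blast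
  also have "\<dots> \<le> support (level G (H_sup G h n) ?m) h e"
    using G Suc.prems by (intro support_mono subgraph_level_mono edge_nonempty Suc.IH)
      (auto simp: finite_simple_graph_def)
  finally show ?case
    using le_H_sup_Suc_iff[OF G Suc.prems] by blast
qed

lemma H_sup_eventually_const:
  assumes G: "finite_simple_graph G"
  shows "\<exists>l N. \<forall>n\<ge>N. \<forall>e\<in>edges G. H_sup G h n e = l e"
proof -
  have "\<forall>e\<in>edges G. \<exists>l. eventually (\<lambda>n. H_sup G h n e = l) sequentially"
    by (intro ballI nat_decseq_eventually_const decseq_SucI H_sup_Suc_le G)
  then obtain l where l: "\<forall>e\<in>edges G. eventually (\<lambda>n. H_sup G h n e = l e) sequentially"
    by metis
  \<comment> \<open>Each edge has its own index of stabilization; finiteness yields a common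
    one.\<close>
  have "finite (edges G)"
    using G by (auto simp: finite_simple_graph_def intro: finite_subset[of _ "Pow (verts G)"])
  then have "eventually (\<lambda>n. \<forall>e\<in>edges G. H_sup G h n e = l e) sequentially"
    using l by (rule eventually_ball_finite)
  then show ?thesis
    unfolding eventually_sequentially by blast
qed

section \<open>Trusses and the limit\<close>

lemma truss_subgraph_le_H_sup:
  assumes G: "finite_simple_graph G" and S: "truss_subgraph G h k S" and "e \<in> edges S"
  shows "k - 2 \<le> int (H_sup G h n e)"
  using assms(3)
proof (induction n arbitrary: e)
  case 0
  have "k - 2 \<le> int (support S h e)" "subgraph S G" "e \<in> edges G"
    using S 0 by (auto simp: truss_subgraph_def subgraph_def)
  moreover have "support S h e \<le> support G h e"
    using calculation G by (intro support_mono edge_nonempty) (auto simp: finite_simple_graph_def)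
  ultimately show ?case
    by simp
next
  case (Suc n)
  \<comment> \<open>For \<open>k < 2\<close> the threshold is truncated to 0, where the claim is
    trivial. The induction hypothesis places all of \<open>S\<close> inside
    \<open>?L\<close>.\<close>
  let ?L = "level G (H_sup G h n) (nat (k - 2))"
  have "k - 2 \<le> int (support S h e)" and SG: "subgraph S G" and e: "e \<in> edges G"
    using S Suc.prems by (auto simp: truss_subgraph_def subgraph_def)
  moreover have "subgraph S ?L"
    using SG Suc.IH by (auto simp: subgraph_def nat_le_iff)
  then have "support S h e \<le> support ?L h e"
    using G e by (intro support_mono edge_nonempty) (auto simp: finite_simple_graph_def)
  ultimately have "nat (k - 2) \<le> support ?L h e"
    by linarith
  then have "nat (k - 2) \<le> H_sup G h (Suc n) e"
    using le_H_sup_Suc_iff[OF G e] by blast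
  then show ?case
    by linarith
qed

text \<open>Supports only grow when passing to a larger graph, so the union of all admissible
  subgraphs is admissible. Hence a greatest one exists, it is the unique maximal one, and the
  \<open>THE\<close> in \<open>truss\<close> is well defined.\<close>

lemma truss_properties:
  assumes G: "finite_simple_graph G"
  shows truss_subgraph_truss: "truss_subgraph G h k (truss G h k)"
    and subgraph_truss: "truss_subgraph G h k S \<Longrightarrow> subgraph S (truss G h k)"
proof -
  \<comment> \<open>Isolated vertices put no condition on supports, so maximality forces all of
    \<open>verts G\<close>.\<close>
  define U where "U = UGraph (verts G) (\<Union>S\<in>{S. truss_subgraph G h k S}. edges S)"
  have le_U: "subgraph S U" if "truss_subgraph G h k S" for S
    using that by (auto simp: U_def truss_subgraph_def subgraph_def)
  have UG: "subgraph U G"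
    using G by (auto simp: U_def truss_subgraph_def subgraph_def finite_simple_graph_def)
  have U: "truss_subgraph G h k U"
    unfolding truss_subgraph_def
  proof (intro conjI ballI UG)
    fix f assume f: "f \<in> edges U"
    then obtain S where S: "truss_subgraph G h k S" "f \<in> edges S"
      by (auto simp: U_def)
    have "f \<in> edges G"
      using f UG by (auto simp: subgraph_def)
    then have "support S h f \<le> support U h f"
      using G S by (intro support_mono le_U edge_nonempty) (auto simp: U_def finite_simple_graph_def)
    then show "int (support U h f) \<ge> k - 2"
      using S by (force simp: truss_subgraph_def)
  qed
  have eq_U: "S = U" if "truss_subgraph G h k S" "subgraph U S" for S
    using that(2) le_U[OF that(1)] unfolding subgraph_def by (intro ugraph.expand) auto
  have "truss G h k = U"
    unfolding truss_def
  proof (rule the_equality, intro conjI allI impI)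
    show "truss_subgraph G h k U"
      by (fact U)
    show "S' = U" if "truss_subgraph G h k S' \<and> subgraph U S'" for S'
      using that eq_U by simp
    show "S = U"
      if "truss_subgraph G h k S \<and> (\<forall>S'. truss_subgraph G h k S' \<and> subgraph S S' \<longrightarrow> S' = S)" for S
      using that U le_U by metis
  qed
  then show "truss_subgraph G h k (truss G h k)"
    and "truss_subgraph G h k S \<Longrightarrow> subgraph S (truss G h k)"
    using U le_U by auto
qed

lemma trussness_eq_H_sup_limit:
  assumes G: "finite_simple_graph G" and e: "e \<in> edges G"
    and lim: "\<And>n f. n \<ge> N \<Longrightarrow> f \<in> edges G \<Longrightarrow> H_sup G h n f = l f"
  shows "trussness G h e = int (l e) + 2"
  unfolding trussness_def
proof (rule Greatest_equality)
  let ?L = "level G (H_sup G h N) (l e)"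
  have "truss_subgraph G h (int (l e) + 2) ?L"
    unfolding truss_subgraph_def
  proof (intro conjI ballI subgraph_level G)
    fix f assume "f \<in> edges ?L"
    \<comment> \<open>Stability lets the bound at index \<open>N\<close> be read at
      \<open>Suc N\<close>, where it becomes a support bound in the level graph of index
      \<open>N\<close>, that is, in \<open>?L\<close> itself.\<close>
    then have f: "f \<in> edges G" "l e \<le> H_sup G h (Suc N) f"
      using lim[of N f] lim[of "Suc N" f] by (simp_all del: H_sup.simps)
    have "l e \<le> support ?L h f"
      using f(2) by (rule le_H_sup_Suc_iff[OF G f(1), THEN iffD1])
    then show "int (support ?L h f) \<ge> int (l e) + 2 - 2"
      by simp
  qed
  moreover have "e \<in> edges ?L"
    using e lim[OF order_refl e] by simp
  ultimately show "e \<in> edges (truss G h (int (l e) + 2))"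
    using subgraph_truss[OF G] unfolding subgraph_def by blast
next
  \<comment> \<open>Conversely, a truss containing \<open>e\<close> bounds every term of the
    sequence at \<open>e\<close> from below, in particular the stable value.\<close>
  fix k assume "e \<in> edges (truss G h k)"
  then have "k - 2 \<le> int (H_sup G h N e)"
    using truss_subgraph_le_H_sup[OF G truss_subgraph_truss[OF G]] by blast
  then show "k \<le> int (l e) + 2"
    using lim[OF order_refl e] by simp
qed

theorem theorem2:
  fixes G :: "'a ugraph" and h :: nat and e :: "'a set"
  assumes "finite_simple_graph G"
    and "h \<ge> 1"
    and "e \<in> edges G"
  shows "(\<lambda>n. real (H_sup G h n e)) \<longlonglongrightarrow> real_of_int (trussness G h e - 2)"
proof -
  obtain l N where lim: "\<forall>n\<ge>N. \<forall>f\<in>edges G. H_sup G h n f = l f"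
    using H_sup_eventually_const[OF assms(1)] by blast
  have "trussness G h e = int (l e) + 2"
    by (rule trussness_eq_H_sup_limit[where N = N, OF assms(1,3)]) (simp only: lim)
  moreover have "eventually (\<lambda>n. real (H_sup G h n e) = real (l e)) sequentially"
    by (rule eventually_sequentiallyI[of N]) (simp only: lim assms(3))
  ultimately show ?thesis
    by (simp add: tendsto_eventually)
qed

end
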